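(* Let $z_{k-1}\in\mathbb{R}^{n+1}$, $z_k=z_{k-1}+\alpha_{k-1}d_{k-1}$ with $\alpha_{k-1}>0$ and $d_{k-1}\neq0$, $s_{k-1}=z_k-z_{k-1}$, $g_j=\nabla\Phi_\tau(z_j)$ for $j=k-1,k$, and suppose $b_k=y_{k-1}:=g_k-g_{k-1}\neq0$. Let $\vartheta>1$, $\mu_k\ge0$, let $d_k$ be the enhanced three-term direction defined in the context, and let $$\widetilde y_{k-1}=y_{k-1}+\vartheta\sqrt{\frac{y_{k-1}^TP_k^{-1}y_{k-1}}{s_{k-1}^TP_ks_{k-1}}}\;P_ks_{k-1}.$$ Then $d_k$ satisfies the modified Dai--Liao generalized conjugacy relation $$d_k^T\widetilde y_{k-1}=-\theta_k\,g_k^Ts_{k-1},\qquad \theta_k=\frac{\widetilde y_{k-1}^TP_k^{-1}\widetilde y_{k-1}}{s_{k-1}^T\widetilde y_{k-1}}+\mu_k\frac{s_{k-1}^T\widetilde y_{k-1}}{s_{k-1}^TP_ks_{k-1}}>0 .$$ If the preceding step is an exact line search, i.e. $\alpha_{k-1}$ minimizes $\alpha\mapsto\Phi_\tau(z_{k-1}+\alpha d_{k-1})$ over $\alpha>0$, then $g_k^Ts_{k-1}=0$ and hence $d_k^T\widetilde y_{k-1}=0$.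
   Context: Let $f_1,\dots,f_m\in C^1(\mathbb{R}^n)$ have gradients that are Lipschitz on $\mathbb{R}^n$ with constants $L_i\ge0$; $\bar L=\sum_i L_i$; $\tau>0$, $\delta>0$. Let $\phi_\tau(r)=\frac{r+\sqrt{r^2+\tau^2}}{2}$ and $\Phi_\tau(x,t)=t+\sum_{i=1}^m\phi_\tau(f_i(x)-t)$ on $\mathbb{R}^{n+1}$. At $z_k=(x_k,t_k)$ let $\omega_{i,k}=\sqrt{(f_i(x_k)-t_k)^2+\tau^2}$, $J_k$ the $m\times(n+1)$ matrix with rows $(\nabla f_i(x_k)^T,-1)$, $D_k=\operatorname{diag}(\omega_{1,k}^{-1},\dots,\omega_{m,k}^{-1})$, $\Pi_x=\operatorname{diag}(I_n,0)$, and $P_k=\delta I_{n+1}+\bar L\Pi_x+\frac12J_k^TD_kJ_k$, a symmetric positive definite matrix. Put $C_k=s_{k-1}^TP_ks_{k-1}$, $B_k=b_k^TP_k^{-1}b_k$, $\Delta_k=s_{k-1}^Tb_k$, $\mathcal{D}_k=\Delta_k+\vartheta\sqrt{C_kB_k}$ (which is positive). The enhanced direction is $$d_k=-P_k^{-1}g_k+\left[\frac{g_k^TP_k^{-1}b_k}{\mathcal{D}_k}-\mu_k\frac{g_k^Ts_{k-1}}{C_k}\right]s_{k-1}-\frac{g_k^Ts_{k-1}}{\mathcal{D}_k}P_k^{-1}b_k.$$ *)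

theory Defs
  imports "HOL-Analysis.Analysis"
begin

definition grad :: "('a::real_inner \<Rightarrow> real) \<Rightarrow> 'a \<Rightarrow> 'a" where
  "grad F z = (THE D. GDERIV F z :> D)"

lemma grad_eqI:
  assumes "GDERIV F z :> D"
  shows "grad F z = D"
  unfolding grad_def
proof (rule the_equality)
  show "GDERIV F z :> D" by (rule assms)
next
  fix E
  assume "GDERIV F z :> E"
  then have "(\<lambda>h. inner h E) = (\<lambda>h. inner h D)"
    using assms has_derivative_unique unfolding gderiv_def by blast
  then have "inner (E - D) E = inner (E - D) D"
    by metis
  then have "inner (E - D) (E - D) = 0"
    by (simp add: inner_diff_right)
  then show "E = D" by simp
qed

text \<open>
  A point \<open>z = (x, t)\<close> of \<open>(n+1)\<close>-dimensional space has type \<open>real^('n option)\<close>: the indices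
  \<open>Some j\<close> carry \<open>x\<close> and the last index \<open>None\<close> carries \<open>t\<close>.
\<close>

definition xpart :: "real^('n::finite option) \<Rightarrow> real^'n" where
  "xpart z = (\<chi> j. z $ Some j)"

definition tpart :: "real^('n::finite option) \<Rightarrow> real" where
  "tpart z = z $ None"

definition phi :: "real \<Rightarrow> real \<Rightarrow> real" where
  "phi \<tau> r = (r + sqrt (r\<^sup>2 + \<tau>\<^sup>2)) / 2"

definition Phi :: "real \<Rightarrow> ('m::finite \<Rightarrow> real^'n \<Rightarrow> real) \<Rightarrow> real^('n::finite option) \<Rightarrow> real" where
  "Phi \<tau> f z = tpart z + (\<Sum>i\<in>UNIV. phi \<tau> (f i (xpart z) - tpart z))"

definition omega :: "real \<Rightarrow> ('m::finite \<Rightarrow> real^'n \<Rightarrow> real) \<Rightarrow> real^('n::finite option) \<Rightarrow> 'm \<Rightarrow> real" where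
  "omega \<tau> f z i = sqrt ((f i (xpart z) - tpart z)\<^sup>2 + \<tau>\<^sup>2)"

definition Jmat :: "('m::finite \<Rightarrow> real^'n \<Rightarrow> real) \<Rightarrow> real^('n::finite option) \<Rightarrow> real^('n option)^'m" where
  "Jmat f z = (\<chi> i c. case c of Some j \<Rightarrow> grad (f i) (xpart z) $ j | None \<Rightarrow> -1)"

definition diag :: "('a::finite \<Rightarrow> real) \<Rightarrow> real^'a^'a" where
  "diag v = (\<chi> i j. if i = j then v i else 0)"

definition Dmat :: "real \<Rightarrow> ('m::finite \<Rightarrow> real^'n \<Rightarrow> real) \<Rightarrow> real^('n::finite option) \<Rightarrow> real^'m^'m" where
  "Dmat \<tau> f z = diag (\<lambda>i. inverse (omega \<tau> f z i))"

definition Pix :: "real^('n::finite option)^('n option)" where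
  "Pix = diag (\<lambda>c. case c of Some j \<Rightarrow> 1 | None \<Rightarrow> 0)"

definition Pmat ::
  "real \<Rightarrow> real \<Rightarrow> ('m::finite \<Rightarrow> real) \<Rightarrow> ('m \<Rightarrow> real^'n \<Rightarrow> real) \<Rightarrow> real^('n::finite option)
    \<Rightarrow> real^('n option)^('n option)" where
  "Pmat \<delta> \<tau> L f z =
     \<delta> *\<^sub>R mat 1 + (\<Sum>i\<in>UNIV. L i) *\<^sub>R Pix
       + (1/2) *\<^sub>R (transpose (Jmat f z) ** Dmat \<tau> f z ** Jmat f z)"

definition enhanced_direction ::
  "real^'a^'a \<Rightarrow> real^'a \<Rightarrow> real^'a \<Rightarrow> real^'a \<Rightarrow> real \<Rightarrow> real \<Rightarrow> real^'a::finite" where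
  "enhanced_direction P g s b vartheta \<mu> =
     (let C = s \<bullet> (P *v s);
          B = b \<bullet> (matrix_inv P *v b);
          \<Delta> = s \<bullet> b;
          \<D> = \<Delta> + vartheta * sqrt (C * B)
      in - (matrix_inv P *v g)
         + ((g \<bullet> (matrix_inv P *v b)) / \<D> - \<mu> * ((g \<bullet> s) / C)) *\<^sub>R s
         - ((g \<bullet> s) / \<D>) *\<^sub>R (matrix_inv P *v b))"

end

theory Submission
  imports Defs
begin

text \<open>
  The relation is an algebraic fact about an arbitrary symmetric positive definite matrix \<open>P\<close>.
  Its inverse is again symmetric and positive definite, and Cauchy--Schwarz for the form of \<open>P\<close>,
  applied to \<open>s\<close> and \<open>P\<^sup>-\<^sup>1 b\<close>, gives \<open>(s\<^sup>T b)\<^sup>2 \<le> C B\<close>. As \<open>vartheta > 1\<close>, the denominator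
  \<open>\<D> = s\<^sup>T b + vartheta \<surd>(C B)\<close> is positive. The weight of \<open>P s\<close> in the modified difference is chosen
  exactly so that \<open>s\<^sup>T ytilde = \<D>\<close>. Pairing the direction with \<open>ytilde\<close>, the coefficient
  \<open>(g\<^sup>T P\<^sup>-\<^sup>1 b) / \<D>\<close> of \<open>s\<close> therefore cancels the part \<open>g\<^sup>T P\<^sup>-\<^sup>1 b\<close> of \<open>g\<^sup>T P\<^sup>-\<^sup>1 ytilde\<close>, and everything
  left over is a multiple of \<open>g\<^sup>T s\<close>; this is \<open>enhanced_direction_conjugacy\<close>.

  The matrix of the theorem is the positive multiple \<open>\<delta> I\<close> of the identity plus two symmetric
  positive semidefinite matrices, so that it is covered by this fact (\<open>spd_matrix_Pmat\<close>).

  For the exact line search, \<open>\<alpha>\<close> is an interior minimizer over \<open>a > 0\<close>, so the derivative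
  \<open>g\<^sup>T d'\<close> along the line vanishes, and \<open>s = \<alpha> d'\<close>. The only analytic input is that \<open>\<Phi>\<close> is
  differentiable; this makes \<open>grad\<close>, a definite description, its actual gradient.
\<close>

section \<open>Symmetric positive definite matrices\<close>

locale spd_matrix =
  fixes P :: "real^'a^'a::finite"
  assumes symmetric: "transpose P = P"
    and positive: "v \<noteq> 0 \<Longrightarrow> 0 < v \<bullet> (P *v v)"
begin

lemma inner_mult_left: "(P *v u) \<bullet> v = u \<bullet> (P *v v)"
  by (metis dot_lmul_matrix symmetric transpose_matrix_vector)

lemma nonneg: "0 \<le> v \<bullet> (P *v v)"
  using positive[of v] by (cases "v = 0") auto

lemma invertible: "invertible P"
proof -
  have "P *v v = 0 \<longrightarrow> v = 0" for v
    using positive[of v] by (metis inner_zero_right less_irrefl)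
  then show ?thesis
    by (simp add: invertible_left_inverse matrix_left_invertible_ker)
qed

lemma matrix_inv: "P ** matrix_inv P = mat 1" "matrix_inv P ** P = mat 1"
  using someI_ex[OF invertible[unfolded invertible_def]] unfolding matrix_inv_def by auto

lemma mult_inv [simp]: "P *v (matrix_inv P *v v) = v"
  by (simp add: matrix_vector_mul_assoc matrix_inv)

lemma inv_mult [simp]: "matrix_inv P *v (P *v v) = v"
  by (simp add: matrix_vector_mul_assoc matrix_inv)

lemma inner_inv_left: "(matrix_inv P *v u) \<bullet> v = u \<bullet> (matrix_inv P *v v)"
  by (metis inner_mult_left mult_inv)

lemma inv_positive:
  assumes "v \<noteq> 0"
  shows "0 < v \<bullet> (matrix_inv P *v v)"
proof -
  have "matrix_inv P *v v \<noteq> 0"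
    using assms by (metis matrix_vector_mult_0_right mult_inv)
  from positive[OF this] show ?thesis
    by (simp add: inner_commute)
qed

text \<open>
  Expanding the form at \<open>C v - w u\<close>, where \<open>C\<close> is its value at \<open>u\<close> and \<open>w\<close> its value at the pair,
  leaves \<open>C\<close> times the difference of the two sides.
\<close>

lemma Cauchy_Schwarz: "(u \<bullet> (P *v v))\<^sup>2 \<le> (u \<bullet> (P *v u)) * (v \<bullet> (P *v v))"
proof (cases "u = 0")
  case False
  define C V w where "C = u \<bullet> (P *v u)" and "V = v \<bullet> (P *v v)" and "w = u \<bullet> (P *v v)"
  have C: "0 < C"
    using positive[OF False] by (simp add: C_def)
  have w': "v \<bullet> (P *v u) = w"
    unfolding w_def by (metis inner_commute inner_mult_left)
  have "0 \<le> (C *\<^sub>R v - w *\<^sub>R u) \<bullet> (P *v (C *\<^sub>R v - w *\<^sub>R u))"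
    by (rule nonneg)
  also have "\<dots> = C * (C * V - w\<^sup>2)"
    by (simp add: matrix_vector_mult_diff_distrib matrix_vector_mult_scaleR inner_diff_left
        inner_diff_right w' flip: C_def V_def w_def)
      (simp add: algebra_simps power2_eq_square)
  finally show ?thesis
    using C by (simp add: zero_le_mult_iff flip: C_def V_def w_def)
qed simp

lemma Cauchy_Schwarz_dual: "(s \<bullet> b)\<^sup>2 \<le> (s \<bullet> (P *v s)) * (b \<bullet> (matrix_inv P *v b))"
  using Cauchy_Schwarz[of s "matrix_inv P *v b"] by (simp add: inner_commute)

section \<open>The conjugacy relation\<close>

text \<open>
  The dual Cauchy--Schwarz inequality bounds \<open>s\<^sup>T b\<close> below by \<open>- \<surd>(C B)\<close>; strictness comes from
  \<open>vartheta > 1\<close> together with \<open>C, B > 0\<close>.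
\<close>

lemma denominator_positive:
  assumes "s \<noteq> 0" and "b \<noteq> 0" and "vartheta > 1"
  shows "0 < s \<bullet> b + vartheta * sqrt ((s \<bullet> (P *v s)) * (b \<bullet> (matrix_inv P *v b)))"
proof -
  define R where "R = sqrt ((s \<bullet> (P *v s)) * (b \<bullet> (matrix_inv P *v b)))"
  have "0 < R"
    using positive[OF assms(1)] inv_positive[OF assms(2)] by (simp add: R_def)
  then have "R < vartheta * R"
    using assms(3) by simp
  moreover have "\<bar>s \<bullet> b\<bar> \<le> R"
    unfolding R_def by (metis Cauchy_Schwarz_dual real_sqrt_abs real_sqrt_le_mono)
  ultimately show ?thesis
    unfolding R_def by linarith
qed

lemma inner_modified_difference:
  assumes "s \<noteq> 0" and "b \<noteq> 0"
  shows "s \<bullet> (b + (vartheta * sqrt ((b \<bullet> (matrix_inv P *v b)) / (s \<bullet> (P *v s)))) *\<^sub>R (P *v s))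
    = s \<bullet> b + vartheta * sqrt ((s \<bullet> (P *v s)) * (b \<bullet> (matrix_inv P *v b)))"
proof -
  have "sqrt (B / C) * C = sqrt (C * B)" if "0 < C" for B C :: real
    using that by (simp add: real_sqrt_divide real_sqrt_mult field_simps)
  then show ?thesis
    using positive[OF assms(1)] by (simp add: inner_add_right)
qed

text \<open>
  With \<open>c\<close> the weight of \<open>P s\<close> in \<open>ytilde\<close> and \<open>q = P\<^sup>-\<^sup>1 b\<close>, everything reduces to
  \<open>s\<^sup>T ytilde = \<D>\<close> and \<open>P\<^sup>-\<^sup>1 ytilde = q + c s\<close>: the second identity splits both \<open>g\<^sup>T P\<^sup>-\<^sup>1 ytilde\<close> and
  the numerator of \<open>\<theta>\<close>, and the first one makes the terms \<open>g\<^sup>T q\<close> cancel.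
\<close>

lemma enhanced_direction_conjugacy:
  fixes g s b :: "real^'a"
  assumes "s \<noteq> 0" and "b \<noteq> 0" and "vartheta > 1" and "\<mu> \<ge> 0"
    and ytilde: "ytilde
      = b + (vartheta * sqrt ((b \<bullet> (matrix_inv P *v b)) / (s \<bullet> (P *v s)))) *\<^sub>R (P *v s)"
    and \<theta>: "\<theta> = (ytilde \<bullet> (matrix_inv P *v ytilde)) / (s \<bullet> ytilde)
      + \<mu> * ((s \<bullet> ytilde) / (s \<bullet> (P *v s)))"
  shows "enhanced_direction P g s b vartheta \<mu> \<bullet> ytilde = - \<theta> * (g \<bullet> s)" and "\<theta> > 0"
proof -
  define c where "c = vartheta * sqrt ((b \<bullet> (matrix_inv P *v b)) / (s \<bullet> (P *v s)))"
  define C where "C = s \<bullet> (P *v s)"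
  define \<D> where "\<D> = s \<bullet> b + vartheta * sqrt ((s \<bullet> (P *v s)) * (b \<bullet> (matrix_inv P *v b)))"
  define q where "q = matrix_inv P *v b"
  have C: "0 < C"
    using positive[OF assms(1)] by (simp add: C_def)
  have \<D>: "0 < \<D>"
    unfolding \<D>_def using assms(1-3) by (rule denominator_positive)
  have s_ytilde: "s \<bullet> ytilde = \<D>"
    unfolding ytilde \<D>_def using assms(1,2) by (rule inner_modified_difference)
  have inv_ytilde: "matrix_inv P *v ytilde = q + c *\<^sub>R s"
    by (simp add: ytilde q_def c_def matrix_vector_mult_add_rdistrib matrix_vector_right_distrib
        matrix_vector_mult_scaleR)
  have \<theta>_alt: "\<theta> = (q \<bullet> ytilde) / \<D> + c + \<mu> * (\<D> / C)"
    using \<D> unfolding \<theta> s_ytilde inv_ytilde C_def[symmetric]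
    by (simp add: inner_add_right inner_commute[of ytilde] s_ytilde add_divide_distrib)
  have g_ytilde: "(matrix_inv P *v g) \<bullet> ytilde = g \<bullet> q + c * (g \<bullet> s)"
    by (simp add: inner_inv_left inv_ytilde inner_add_right)
  have "enhanced_direction P g s b vartheta \<mu> \<bullet> ytilde
      = - (g \<bullet> q + c * (g \<bullet> s)) + ((g \<bullet> q) / \<D> - \<mu> * ((g \<bullet> s) / C)) * \<D>
        - ((g \<bullet> s) / \<D>) * (q \<bullet> ytilde)"
    unfolding enhanced_direction_def Let_def \<D>_def[symmetric] unfolding q_def[symmetric] C_def[symmetric]
    by (simp add: inner_add_left inner_diff_left g_ytilde s_ytilde)
  also have "\<dots> = - \<theta> * (g \<bullet> s)"
    using C \<D> unfolding \<theta>_alt by (simp add: field_simps)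
  finally show "enhanced_direction P g s b vartheta \<mu> \<bullet> ytilde = - \<theta> * (g \<bullet> s)" .
  have "ytilde \<noteq> 0"
    using s_ytilde \<D> by auto
  then show "\<theta> > 0"
    unfolding \<theta> s_ytilde C_def[symmetric] using \<D> C assms(4) inv_positive[of ytilde]
    by (simp add: add_pos_nonneg)
qed

end

section \<open>The preconditioner is symmetric positive definite\<close>

lemma transpose_diag [simp]: "transpose (diag v) = diag v"
  by (auto simp: diag_def transpose_def vec_eq_iff)

lemma inner_diag_nonneg:
  assumes "\<And>i. 0 \<le> v i"
  shows "0 \<le> u \<bullet> (diag v *v u)"
proof -
  have "u \<bullet> (diag v *v u) = (\<Sum>i\<in>UNIV. v i * (u $ i)\<^sup>2)"
    by (simp add: diag_def inner_vec_def matrix_vector_mult_def if_distrib if_distribR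
        power2_eq_square mult_ac cong: if_cong)
  also have "\<dots> \<ge> 0"
    by (intro sum_nonneg mult_nonneg_nonneg assms) auto
  finally show ?thesis .
qed

lemma inner_congruence:
  fixes J :: "real^'a^'b"
  shows "v \<bullet> ((transpose J ** D ** J) *v v) = (J *v v) \<bullet> (D *v (J *v v))"
  by (metis dot_lmul_matrix matrix_vector_mul_assoc transpose_matrix_vector transpose_transpose)

lemma transpose_add: "transpose (A + B) = transpose A + transpose B"
  by (simp add: transpose_def vec_eq_iff)

lemma spd_matrix_Pmat:
  assumes "\<And>i. 0 \<le> L i" and "\<delta> > 0"
  shows "spd_matrix (Pmat \<delta> \<tau> L f z)"
proof
  show "transpose (Pmat \<delta> \<tau> L f z) = Pmat \<delta> \<tau> L f z"
    by (simp add: Pmat_def Pix_def Dmat_def transpose_add transpose_scalar transpose_mat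
        matrix_transpose_mul matrix_mul_assoc)
next
  fix v :: "real^('b option)"
  assume "v \<noteq> 0"
  have "v \<bullet> (Pmat \<delta> \<tau> L f z *v v)
      = \<delta> * (v \<bullet> v) + (\<Sum>i\<in>UNIV. L i) * (v \<bullet> (Pix *v v))
        + (1/2) * ((Jmat f z *v v) \<bullet> (Dmat \<tau> f z *v (Jmat f z *v v)))"
    by (simp add: Pmat_def matrix_vector_mult_add_rdistrib scaleR_matrix_vector_assoc[symmetric]
        inner_add_right inner_congruence)
  moreover have "0 \<le> v \<bullet> (Pix *v v)"
    unfolding Pix_def by (rule inner_diag_nonneg) (simp split: option.split)
  moreover have "0 \<le> u \<bullet> (Dmat \<tau> f z *v u)" for u
    unfolding Dmat_def by (rule inner_diag_nonneg) (simp add: omega_def)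
  moreover have "0 < \<delta> * (v \<bullet> v)"
    using \<open>v \<noteq> 0\<close> assms(2) by simp
  ultimately show "0 < v \<bullet> (Pmat \<delta> \<tau> L f z *v v)"
    using assms(1) by (simp add: add_pos_nonneg sum_nonneg)
qed

section \<open>Differentiability and exact line search\<close>

text \<open>A derivative is a linear functional, hence the inner product with its adjoint's value at \<open>1\<close>.\<close>

lemma differentiable_imp_GDERIV_grad:
  fixes F :: "'a::euclidean_space \<Rightarrow> real"
  assumes "F differentiable (at z)"
  shows "GDERIV F z :> grad F z"
proof -
  obtain F' where F': "(F has_derivative F') (at z)"
    using assms by (auto simp: differentiable_def)
  have "F' h = h \<bullet> adjoint F' 1" for h
    using adjoint_works[OF has_derivative_linear[OF F'], of h 1] by simp
  then have "GDERIV F z :> adjoint F' 1"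
    using F' unfolding gderiv_def by (metis (no_types, lifting) ext)
  then show ?thesis
    by (simp add: grad_eqI)
qed

lemma phi_differentiable:
  assumes "\<tau> > 0"
  shows "phi \<tau> differentiable (at r)"
proof -
  have "0 < r\<^sup>2 + \<tau>\<^sup>2"
    using assms by (simp add: add_nonneg_pos)
  then have "\<exists>D. ((\<lambda>r. (r + sqrt (r\<^sup>2 + \<tau>\<^sup>2)) / 2) has_real_derivative D) (at r)"
    by (auto intro!: exI derivative_eq_intros)
  then show ?thesis
    by (auto simp: phi_def[abs_def] real_differentiable_def)
qed

lemma xpart_differentiable: "xpart differentiable (at z)"
proof -
  have "linear xpart"
    by (rule linearI) (simp_all add: xpart_def vec_eq_iff)
  then show ?thesis
    by (rule linear_imp_differentiable)
qed

lemma tpart_differentiable: "tpart differentiable (at z)"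
proof -
  have "linear tpart"
    by (rule linearI) (simp_all add: tpart_def)
  then show ?thesis
    by (rule linear_imp_differentiable)
qed

lemma Phi_differentiable:
  assumes "\<And>i x. f i differentiable (at x)" and "\<tau> > 0"
  shows "Phi \<tau> f differentiable (at z)"
proof -
  have "(\<lambda>z. f i (xpart z)) differentiable (at z)" for i
    using differentiable_chain_at[OF xpart_differentiable assms(1)] by (simp add: o_def)
  then have "(\<lambda>z. f i (xpart z) - tpart z) differentiable (at z)" for i
    by (intro differentiable_diff tpart_differentiable)
  then have "(\<lambda>z. phi \<tau> (f i (xpart z) - tpart z)) differentiable (at z)" for i
    using differentiable_chain_at[OF _ phi_differentiable[OF assms(2)]] by (fastforce simp: o_def)
  then show ?thesis
    unfolding Phi_def[abs_def]
    by (intro differentiable_add differentiable_sum tpart_differentiable) auto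
qed

text \<open>
  The open ray of admissible steps is a neighbourhood of its minimizer, so the restriction of \<open>F\<close> to
  the line has a local minimum there and its derivative is zero.
\<close>

lemma exact_line_search_stationary:
  fixes F :: "'a::real_inner \<Rightarrow> real"
  assumes "GDERIV F (z + \<alpha> *\<^sub>R p) :> G" and "\<alpha> > 0"
    and min: "\<And>a. a > 0 \<Longrightarrow> F (z + \<alpha> *\<^sub>R p) \<le> F (z + a *\<^sub>R p)"
  shows "G \<bullet> p = 0"
proof -
  have line: "((\<lambda>a. z + a *\<^sub>R p) has_derivative (\<lambda>h. h *\<^sub>R p)) (at \<alpha>)"
    by (auto intro!: derivative_eq_intros)
  have "((\<lambda>a. F (z + a *\<^sub>R p)) has_derivative (\<lambda>h. (h *\<^sub>R p) \<bullet> G)) (at \<alpha>)"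
    using has_derivative_compose[OF line] assms(1) by (simp add: gderiv_def del: inner_scaleR_left)
  then have "DERIV (\<lambda>a. F (z + a *\<^sub>R p)) \<alpha> :> p \<bullet> G"
    by (simp add: has_field_derivative_def mult_commute_abs)
  then have "p \<bullet> G = 0"
  proof (rule DERIV_local_min[OF _ assms(2)])
    show "\<forall>a. \<bar>\<alpha> - a\<bar> < \<alpha> \<longrightarrow> F (z + \<alpha> *\<^sub>R p) \<le> F (z + a *\<^sub>R p)"
      using min by force
  qed
  then show ?thesis
    by (simp add: inner_commute)
qed

theorem corollary4p5:
  fixes f :: "'m::finite \<Rightarrow> real^'n::finite \<Rightarrow> real"
    and L :: "'m \<Rightarrow> real"
    and \<tau> \<delta> vartheta \<mu> \<alpha> \<theta> :: real
    and z' z d' s g' g y b d ytilde :: "real^('n option)"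
    and P :: "real^('n option)^('n option)"
  assumes f_diff: "\<And>i x. f i differentiable (at x)"
    and f_C1: "\<And>i. continuous_on UNIV (grad (f i))"
    and L_nonneg: "\<And>i. 0 \<le> L i"
    and f_lip: "\<And>i. (L i)-lipschitz_on UNIV (grad (f i))"
    and "\<tau> > 0" and "\<delta> > 0" and "vartheta > 1" and "\<mu> \<ge> 0"
    and "\<alpha> > 0" and "d' \<noteq> 0"
    and z: "z = z' + \<alpha> *\<^sub>R d'"
    and s: "s = z - z'"
    and g': "g' = grad (Phi \<tau> f) z'"
    and g: "g = grad (Phi \<tau> f) z"
    and y: "y = g - g'"
    and b: "b = y" and b_nonzero: "b \<noteq> 0"
    and P: "P = Pmat \<delta> \<tau> L f z"
    and d: "d = enhanced_direction P g s b vartheta \<mu>"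
    and ytilde: "ytilde = y + (vartheta * sqrt ((y \<bullet> (matrix_inv P *v y)) / (s \<bullet> (P *v s)))) *\<^sub>R (P *v s)"
    and \<theta>: "\<theta> = (ytilde \<bullet> (matrix_inv P *v ytilde)) / (s \<bullet> ytilde)
                 + \<mu> * ((s \<bullet> ytilde) / (s \<bullet> (P *v s)))"
  shows "d \<bullet> ytilde = - \<theta> * (g \<bullet> s) \<and> \<theta> > 0 \<and>
         ((\<forall>a>0. Phi \<tau> f (z' + \<alpha> *\<^sub>R d') \<le> Phi \<tau> f (z' + a *\<^sub>R d'))
            \<longrightarrow> g \<bullet> s = 0 \<and> d \<bullet> ytilde = 0)"
proof -
  interpret spd_matrix P
    unfolding P using L_nonneg \<open>\<delta> > 0\<close> by (rule spd_matrix_Pmat)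
  have s_eq: "s = \<alpha> *\<^sub>R d'"
    by (simp add: s z)
  then have "s \<noteq> 0"
    using \<open>\<alpha> > 0\<close> \<open>d' \<noteq> 0\<close> by simp
  note conjugacy = enhanced_direction_conjugacy[OF this b_nonzero \<open>vartheta > 1\<close> \<open>\<mu> \<ge> 0\<close>
      ytilde[folded b] \<theta>]
  have "g \<bullet> s = 0"
    if "\<forall>a>0. Phi \<tau> f (z' + \<alpha> *\<^sub>R d') \<le> Phi \<tau> f (z' + a *\<^sub>R d')"
  proof -
    have "GDERIV (Phi \<tau> f) (z' + \<alpha> *\<^sub>R d') :> g"
      unfolding g z
      by (intro differentiable_imp_GDERIV_grad Phi_differentiable f_diff \<open>\<tau> > 0\<close>)
    then have "g \<bullet> d' = 0"
      using \<open>\<alpha> > 0\<close> that by (intro exact_line_search_stationary) auto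
    then show ?thesis
      by (simp add: s_eq)
  qed
  with conjugacy show ?thesis
    by (simp add: d)
qed

end
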